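(* Let $n\ge 1$ and let $Z$ be any finite binary string that ends in $n$ zeros and contains every binary string of length $n$ at least once as a substring. Let $V$ be the initial string of length $2^{n+1}$ of $EM_n(Z)$. Then the string $\bar 0_n V$ (that is, the $n$ zeros at the end of $Z$ followed by $V$) is a DeBruijn string of order $n+1$.
   Context: All strings are over the alphabet $\{0,1\}$; for a digit $y$, $y' = 1-y$; $\bar 0_n$ is the string of $n$ zeros. A DeBruijn string of order $m$ is a binary string of length $2^m+m-1$ that contains every binary string of length $m$ as a (contiguous) substring. Definition of $EM_n(Z)$ for $n\ge 1$ and a nonempty finite binary string $Z$: it is the infinite binary sequence $x_1x_2x_3\dots$ generated digit by digit as follows. Suppose $x_1,\dots,x_k$ ($k\ge 0$) have been generated and let $W = Zx_1\cdots x_k$ (concatenation). Let $\sigma$ be the longest tail (suffix, possibly empty) of $W$ with $|\sigma|\le n$ that also occurs as a substring of $W$ with its last digit removed. Take the latest (rightmost) such earlier occurrence and let $y$ be the digit of $W$ immediately following it; if $\sigma$ is empty, the latest previous occurrence is understood to be just before the last digit of $W$, so $y$ is the last digit of $W$. Then $x_{k+1} = y'$. The sequence $EM_n(Z)$ does not include the seed $Z$. *)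

theory Defs
  imports Main "HOL-Library.Sublist"
begin

text \<open>Binary strings are of type \<^typ>\<open>bool list\<close>, with \<^const>\<open>False\<close> for the digit 0 and
  \<^const>\<open>True\<close> for the digit 1; the complement \<open>y' = 1 - y\<close> is negation.\<close>

definition de_bruijn :: "nat \<Rightarrow> bool list \<Rightarrow> bool" where
  "de_bruijn m w \<longleftrightarrow>
     length w = 2 ^ m + m - 1 \<and> (\<forall>u. length u = m \<longrightarrow> sublist u w)"

text \<open>The maximum exists whenever \<open>W\<close> is nonempty (the empty tail qualifies), and it is unique,
  a suffix of \<open>W\<close> being determined by its length.\<close>

definition em_tail :: "nat \<Rightarrow> bool list \<Rightarrow> bool list" where
  "em_tail n W =
     (ARG_MAX length \<sigma>. suffix \<sigma> W \<and> length \<sigma> \<le> n \<and> sublist \<sigma> (butlast W))"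

definition occurs_at :: "'a list \<Rightarrow> 'a list \<Rightarrow> nat \<Rightarrow> bool" where
  "occurs_at s w i \<longleftrightarrow> i + length s \<le> length w \<and> take (length s) (drop i w) = s"

text \<open>Occurrences are sought in \<open>butlast W\<close>, so the latest occurrence of the empty tail
  is at position \<open>length W - 1\<close>, and the digit following it is the last digit of \<open>W\<close>.\<close>

definition em_next :: "nat \<Rightarrow> bool list \<Rightarrow> bool" where
  "em_next n W =
     (let \<sigma> = em_tail n W; i = (GREATEST i. occurs_at \<sigma> (butlast W) i)
      in \<not> W ! (i + length \<sigma>))"

text \<open>Indexing starts at 0: \<open>EM n Z k\<close> is the digit \<open>x\<^bsub>k+1\<^esub>\<close> of the sequence.\<close>

fun EM :: "nat \<Rightarrow> bool list \<Rightarrow> nat \<Rightarrow> bool" where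
  "EM n Z k = em_next n (Z @ map (EM n Z) [0..<k])"

declare EM.simps [simp del]

end

theory Submission imports Defs begin

text \<open>Read the sequence as a walk on the words of length \<open>n\<close>, its edges being the words of
  length \<open>n + 1\<close>. The rule makes the exits from every vertex alternate with respect to the
  latest previous visit, so this is a rotor walk, and the edges by which \<open>Z\<close> leaves
  the vertices for the last time form a tree directed to the final vertex \<open>r\<close> of \<open>Z\<close>. At the first
  repeated edge the walk is at a vertex visited for the third time, which can only be \<open>r\<close>,
  since every vertex has just two incoming edges; hence both edges into \<open>r\<close> have been used.
  If both edges into \<open>v\<close> have been used and the tree edge of \<open>u\<close> goes to \<open>v\<close>, then \<open>u\<close> was left by
  its tree edge, which comes second after \<open>Z\<close>, so \<open>u\<close> was entered twice. Following the
  tree, all edges are used before the first repetition, that is, exactly once.\<close>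

definition window :: "(nat \<Rightarrow> 'a) \<Rightarrow> nat \<Rightarrow> nat \<Rightarrow> 'a list" where
  "window s m i = map s [i..<i + m]"

lemma length_window [simp]: "length (window s m i) = m"
  by (simp add: window_def)

lemma window_Suc: "window s (Suc m) i = window s m i @ [s (i + m)]"
  by (simp add: window_def)

lemma window_Suc_Cons: "window s (Suc m) i = s i # window s m (Suc i)"
  by (simp add: window_def upt_conv_Cons del: upt_Suc)

lemma take_drop_window:
  "i + m \<le> N \<Longrightarrow> take m (drop i (window s N 0)) = window s m i"
  by (simp add: window_def drop_map take_map)

lemma butlast_window: "butlast (window s N i) = window s (N - 1) i"
  by (cases N) (simp_all add: window_Suc, simp add: window_def)

lemma occurs_at_window:
  "occurs_at u (window s N 0) i \<longleftrightarrow> i + length u \<le> N \<and> window s (length u) i = u"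
  by (auto simp: occurs_at_def take_drop_window)

lemma sublist_iff_occurs_at: "sublist u w \<longleftrightarrow> (\<exists>i. occurs_at u w i)"
proof
  assume "sublist u w"
  then obtain ps ss where "w = ps @ u @ ss"
    by (auto simp: sublist_def)
  then have "occurs_at u w (length ps)"
    by (simp add: occurs_at_def)
  then show "\<exists>i. occurs_at u w i" ..
next
  assume "\<exists>i. occurs_at u w i"
  then obtain i where "take (length u) (drop i w) = u"
    by (auto simp: occurs_at_def)
  then show "sublist u w"
    by (metis sublist_drop sublist_order.order_trans sublist_take)
qed

text \<open>The cap \<open>n\<close> makes any recurring suffix of length \<open>n\<close> a longest
  candidate, and suffixes of equal length coincide.\<close>

lemma em_tail_eqI:
  assumes "suffix u W" "length u = n" "sublist u (butlast W)"
  shows "em_tail n W = u"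
proof -
  let ?P = "\<lambda>\<sigma>. suffix \<sigma> W \<and> length \<sigma> \<le> n \<and> sublist \<sigma> (butlast W)"
  have P: "?P (em_tail n W)"
    unfolding em_tail_def by (rule arg_max_natI[where b = "Suc n"]) (use assms in auto)
  have "length (em_tail n W) = length u"
    unfolding em_tail_def by (rule arg_max_equality) (use assms in auto)
  with P assms(1) show ?thesis
    by (metis suffix_length_suffix suffix_order.antisym order_refl)
qed

text \<open>Turns the generating rule into the rotor rule: at a vertex seen before, the tail is the
  whole vertex.\<close>

lemma em_next_window:
  assumes "i < j" "window s n i = window s n j"
    and latest: "\<And>l. i < l \<Longrightarrow> l < j \<Longrightarrow> window s n l \<noteq> window s n j"
  shows "em_next n (window s (j + n) 0) \<longleftrightarrow> \<not> s (i + n)"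
proof -
  let ?W = "window s (j + n) 0" and ?u = "window s n j"
  have occ: "occurs_at ?u (butlast ?W) i"
    using assms(1,2) by (simp add: butlast_window occurs_at_window)
  have "drop j ?W = ?u"
    by (simp add: window_def drop_map)
  then have "suffix ?u ?W"
    by (metis suffix_drop)
  then have tail: "em_tail n ?W = ?u"
    using occ by (intro em_tail_eqI) (auto simp: sublist_iff_occurs_at)
  have "(GREATEST i. occurs_at ?u (butlast ?W) i) = i"
  proof (rule Greatest_equality)
    show "occurs_at ?u (butlast ?W) i"
      by (rule occ)
  next
    fix y assume y: "occurs_at ?u (butlast ?W) y"
    \<comment> \<open>Truncated subtraction is harmless here, since \<open>i < j\<close> makes
      \<open>j\<close> positive.\<close>
    then have "y + n \<le> j + n - 1" "window s n y = ?u"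
      by (simp_all add: butlast_window occurs_at_window)
    moreover from this \<open>i < j\<close> have "y < j"
      by linarith
    ultimately show "y \<le> i"
      using latest[of y] by force
  qed
  with tail \<open>i < j\<close> show ?thesis
    by (simp add: em_next_def window_def)
qed

lemma bool_third:
  fixes x y z :: bool
  shows "x \<noteq> y \<Longrightarrow> z = x \<or> z = y"
  by auto

text \<open>Only exits from time \<open>a\<close> on must alternate, but the previous visit
  \<open>i\<close> may lie before \<open>a\<close>; this ties the walk to the last exits of the
  seed.\<close>

lemma rotor_walk_covers:
  fixes s :: "nat \<Rightarrow> bool"
  assumes covers: "\<And>u. length u = n \<Longrightarrow> \<exists>i\<le>a. window s n i = u"
    and alternates: "\<And>i j. \<lbrakk>i < j; a \<le> j; window s n i = window s n j;
        \<And>l. i < l \<Longrightarrow> l < j \<Longrightarrow> window s n l \<noteq> window s n j\<rbrakk> \<Longrightarrow> s (i + n) \<noteq> s (j + n)"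
    and "length u = Suc n"
  shows "\<exists>j. a \<le> j \<and> j < a + 2 ^ Suc n \<and> window s (Suc n) j = u"
proof -
  let ?p = "window s n" and ?E = "window s (Suc n)"
  have words: "finite {u :: bool list. length u = Suc n}"
    "card {u :: bool list. length u = Suc n} = 2 ^ Suc n"
    using finite_lists_length_eq[of "UNIV :: bool set" "Suc n"]
      card_lists_length_eq[of "UNIV :: bool set" "Suc n"] by (simp_all add: card_UNIV_bool)
  have "\<not> inj_on ?E {a..}"
  proof
    assume "inj_on ?E {a..}"
    then have "finite {a..}"
      by (rule inj_on_finite[OF _ _ words(1)]) auto
    then show False
      using infinite_Ici by blast
  qed
  then have "\<exists>T i. a \<le> i \<and> i < T \<and> ?E i = ?E T"
    unfolding inj_on_def by (metis atLeast_iff linorder_neqE_nat)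
  \<comment> \<open>\<open>T\<close> is the first time at which an edge used since \<open>a\<close>
    recurs.\<close>
  then obtain T where T: "\<exists>i. a \<le> i \<and> i < T \<and> ?E i = ?E T"
    and min: "\<And>T'. T' < T \<Longrightarrow> \<not> (\<exists>i. a \<le> i \<and> i < T' \<and> ?E i = ?E T')"
    using exists_least_iff[of "\<lambda>T. \<exists>i. a \<le> i \<and> i < T \<and> ?E i = ?E T"] by auto
  have inj: "inj_on ?E {a..<T}"
    by (rule linorder_inj_onI) (use min in auto)
  \<comment> \<open>Equal preceding digits would repeat an edge at time \<open>j - 1\<close>, which
    is below \<open>T\<close> even when \<open>j = T\<close>.\<close>
  have entered_differently: "s (i - 1) \<noteq> s (j - 1)"
    if "a < i" "i < j" "j \<le> T" "?p i = ?p j" for i j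
    using that min[of "j - 1"] by (cases i; cases j) (auto simp: window_Suc_Cons)
  \<comment> \<open>Both edges into \<open>v\<close> are used between \<open>a\<close> and
    \<open>T\<close>.\<close>
  define full where "full v \<longleftrightarrow> (\<forall>c. \<exists>j\<in>{a..<T}. ?E j = c # v)" for v
  have fullI: "full (?p j)" if "a < i" "i < j" "j \<le> T" "?p i = ?p j" for i j
    unfolding full_def
  proof
    fix c
    have "s (i - 1) \<noteq> s (j - 1)"
      using entered_differently that by blast
    from bool_third[OF this, of c] obtain k where "k = i \<or> k = j" "c = s (k - 1)"
      by blast
    with that have "k - 1 \<in> {a..<T}" "?E (k - 1) = c # ?p j"
      by (auto simp: window_Suc_Cons)
    then show "\<exists>j'\<in>{a..<T}. ?E j' = c # ?p j"
      by blast
  qed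
  have root: "full (?p a)"
  proof -
    obtain i where i: "a \<le> i" "i < T" "?p i = ?p T" "s (i + n) = s (T + n)"
      using T by (auto simp: window_Suc)
    \<comment> \<open>Equal exits at \<open>i\<close> and \<open>T\<close> mean that
      \<open>i\<close> is not the latest visit before \<open>T\<close>.\<close>
    then obtain l where l: "i < l" "l < T" "?p l = ?p T"
      using alternates[of i T] by force
    \<comment> \<open>Otherwise \<open>i\<close>, \<open>l\<close> and \<open>T\<close> would need
      three distinct entering digits.\<close>
    have "i = a"
    proof (rule ccontr)
      assume "i \<noteq> a"
      with i l show False
        using entered_differently[of i l] entered_differently[of i T] entered_differently[of l T]
        by simp
    qed
    with i l fullI[of l T] show ?thesis
      by simp
  qed
  have step: "full (?p i)" if "i \<le> a" for i
    using that
  proof (induction "a - i" arbitrary: i rule: less_induct)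
    case less
    show ?case
    proof (cases "\<exists>l>i. l \<le> a \<and> ?p l = ?p i")
      case True
      then obtain l where "i < l" "l \<le> a" "?p l = ?p i"
        by blast
      with less.hyps[of l] show ?thesis
        by simp
    next
      \<comment> \<open>Now \<open>i\<close> is the last visit up to \<open>a\<close>, so for
        \<open>i < a\<close> the edge \<open>?E i\<close> is the tree edge.\<close>
      case False
      show ?thesis
      proof (cases "i = a")
        case True
        with root show ?thesis
          by simp
      next
        case neq: False
        with less have "full (?p (Suc i))"
          by simp
        then obtain j where j: "a \<le> j" "j < T" "?E j = ?E i"
          unfolding full_def window_Suc_Cons[of s n i] by (meson atLeastLessThan_iff)
        then have pj: "?p i = ?p j" "s (i + n) = s (j + n)"
          by (simp_all add: window_Suc)
        moreover have "i < j"
          using neq less.prems j by simp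
        \<comment> \<open>The tree edge recurs at \<open>j\<close>, so alternation forces a visit in
          between. It comes after \<open>a\<close>, so \<open>m\<close> and \<open>j\<close> give
          two entries.\<close>
        ultimately obtain m where m: "i < m" "m < j" "?p m = ?p j"
          using alternates[of i j] j by blast
        with False pj have "a < m"
          by (metis not_le)
        with m j fullI[of m j] pj show ?thesis
          by simp
      qed
    qed
  qed
  have all: "\<exists>j\<in>{a..<T}. ?E j = w" if "length w = Suc n" for w
  proof -
    from that obtain c v where "w = c # v" "length v = n"
      by (auto simp: length_Suc_conv)
    moreover obtain i where "i \<le> a" "?p i = v"
      using covers[OF \<open>length v = n\<close>] by blast
    ultimately show ?thesis
      using step[of i] by (simp add: full_def)
  qed
  \<comment> \<open>No edge repeats before \<open>T\<close>, so the number of edges bounds the time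
    taken.\<close>
  have "card {a..<T} \<le> 2 ^ Suc n"
    unfolding words(2)[symmetric] by (rule card_inj_on_le[OF inj _ words(1)]) auto
  then have "T \<le> a + 2 ^ Suc n"
    by simp
  with all[OF assms(3)] show ?thesis
    by (metis atLeastLessThan_iff order_less_le_trans)
qed

theorem theorem3p2:
  fixes n :: nat and Z V :: "bool list"
  assumes "n \<ge> 1"
    and "suffix (replicate n False) Z"
    and "\<And>u :: bool list. length u = n \<Longrightarrow> sublist u Z"
    and "V = map (EM n Z) [0..<2 ^ (n + 1)]"
  shows "de_bruijn (n + 1) (replicate n False @ V)"
proof -
  obtain Y where Z: "Z = Y @ replicate n False"
    using assms(2) by (auto simp: suffix_def)
  define a where "a = length Y"
  have len: "length Z = a + n"
    by (simp add: Z a_def)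
  \<comment> \<open>Seed and output form one sequence; its window at \<open>a\<close> is the final
    block of zeros.\<close>
  define s where "s i = (if i < a + n then Z ! i else EM n Z (i - (a + n)))" for i
  have prefix: "window s (a + n + k) 0 = Z @ map (EM n Z) [0..<k]" for k
    by (rule nth_equalityI) (auto simp: window_def s_def len nth_append)
  have digit: "s (j + n) = em_next n (window s (j + n) 0)" if "a \<le> j" for j
  proof -
    define k where "k = j - a"
    have k: "j + n = a + n + k"
      using that by (simp add: k_def)
    have "s (a + n + k) = EM n Z k"
      by (simp add: s_def)
    also have "\<dots> = em_next n (window s (a + n + k) 0)"
      by (subst EM.simps) (simp only: prefix)
    finally show ?thesis
      by (simp only: k)
  qed
  have "\<exists>i\<le>a. window s n i = u" if "length u = n" for u
  proof -
    have "Z = window s (a + n) 0"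
      using prefix[of 0] by simp
    then have "sublist u (window s (a + n) 0)"
      using assms(3)[OF that] by metis
    with that show ?thesis
      by (auto simp: sublist_iff_occurs_at occurs_at_window)
  qed
  moreover have "s (i + n) \<noteq> s (j + n)"
    if "i < j" "a \<le> j" "window s n i = window s n j"
      "\<And>l. i < l \<Longrightarrow> l < j \<Longrightarrow> window s n l \<noteq> window s n j" for i j
    using em_next_window[of i j s n] digit[of j] that by blast
  ultimately have edges: "\<exists>j. a \<le> j \<and> j < a + 2 ^ Suc n \<and> window s (Suc n) j = u"
    if "length u = Suc n" for u
    using rotor_walk_covers[of n a s u] that by blast
  have W: "window s (a + n + 2 ^ Suc n) 0 = Y @ replicate n False @ V"
    by (simp add: prefix assms(4) Z)
  have "sublist u (replicate n False @ V)" if u: "length u = n + 1" for u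
  proof -
    obtain j where j: "a \<le> j" "j < a + 2 ^ Suc n" "window s (Suc n) j = u"
      using edges[of u] u by auto
    then have "take (Suc n) (drop j (Y @ replicate n False @ V)) = u"
      unfolding W[symmetric] by (subst take_drop_window) auto
    moreover have "drop j (Y @ replicate n False @ V) = drop (j - a) (replicate n False @ V)"
      using j(1) by (simp add: a_def)
    ultimately show ?thesis
      by (metis sublist_drop sublist_order.order_trans sublist_take)
  qed
  then show ?thesis
    by (simp add: de_bruijn_def assms(4))
qed

end
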